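(* Let $d,\nu\ge 1$ be integers and let $S\subset\{0,1\}^{\Lambda_\nu}$ be a parking scheme. Let $P_n$ be the jamming limit of the parking process on $\Lambda_n$ with null boundary condition, let $P$ be the limit algorithm, let $\rho_n(\omega)=\dfrac{\sum_{x\in\Lambda_n}P_n(\omega)(x)}{(2n+1)^d}$ be the occupation density, and let $\rho=\mathbb{E}(P(0))\in[0,1]$. Then $\rho_n\to\rho$ as $n\to\infty$, $\lambda_{(0,1)}^{\mathbb{Z}^d}$-almost surely.
   Context: Probability space: $\Omega=(0,1)^{\mathbb{Z}^d}$ with product Borel $\sigma$-algebra and the product $\lambda_{(0,1)}^{\mathbb{Z}^d}$ of Lebesgue measures on $(0,1)$; $\mathbb{E}$ is expectation under it. $|x|_{\sup}=\max_i|x_i|$; $\Lambda_n=\{-n,\dots,n\}^d$. Parking scheme: a subset $S\subset\{0,1\}^{\Lambda_\nu}$ containing the all-zero configuration; $\nu$ is its radius of interaction. Translation: $\theta_x(\eta)(z)=\eta(z+x)$. Parking process on a finite set $X\subset\mathbb{Z}^d$ with null boundary condition: for $\omega\in\Omega$ with pairwise distinct coordinates, start with $\eta=0^{\mathbb{Z}^d}$ and visit the sites of $X$ once each, in increasing order of the values $\omega(x)$; when visiting $x$, if the current configuration $\eta$ satisfies $\theta_x(\eta)|_{\Lambda_\nu}\in S$, then set $\eta(x)=1$, otherwise leave $\eta$ unchanged. The final configuration is denoted $P_X(\omega)\in\{0,1\}^{\mathbb{Z}^d}$ (the jamming limit). Put $P_n=P_{\Lambda_n}$. Armour: a path is a finite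 sequence $(x_i)_{0\le i\le m}$ in $\mathbb{Z}^d$ ($m\ge 0$) with $|x_{i+1}-x_i|_{\sup}\le\nu$ for all $i$; it is decreasing (for $\omega$) if $\omega(x_0)>\omega(x_1)>\dots>\omega(x_m)$. Write $y\uparrow_{(\omega)}x$ if there is a decreasing path from $x_0=x$ to $x_m=y$ (so $x\uparrow_{(\omega)}x$). The armour of $X\subset\mathbb{Z}^d$ is $\mathcal{A}(X)(\omega)=\{y\in\mathbb{Z}^d:\exists x\in X,\ y\uparrow_{(\omega)}x\}$. Limit algorithm: $P(\omega)(x)=P_{\mathcal{A}(\{x\})(\omega)}(\omega)(x)$ for all $x\in\mathbb{Z}^d$. Convention: on the exceptional set of $\omega$ having two equal coordinates, or for which an infinite decreasing path exists (equivalently some $\mathcal{A}(\{x\})(\omega)$ is infinite, when the coordinates are distinct), set $P_n(\omega)=P(\omega)=0^{\mathbb{Z}^d}$ for all $n$. *)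

theory Defs
  imports "HOL-Probability.Probability"
begin

text \<open>Sites of \<open>\<int>\<^sup>d\<close>; the dimension \<open>d = CARD('d) \<ge> 1\<close> is carried by the index type.\<close>

type_synonym 'd site = "(int, 'd) vec"

text \<open>Configurations \<open>\<eta> \<in> {0,1}\<^sup>X\<close>, with \<open>True\<close> for 1 (occupied) and \<open>False\<close> for 0 (empty).\<close>

type_synonym 'd config = "'d site \<Rightarrow> bool"

definition sup_norm :: "'d::finite site \<Rightarrow> int" where
  "sup_norm x = Max (range (\<lambda>i. \<bar>x $ i\<bar>))"

definition cube :: "nat \<Rightarrow> 'd::finite site set" where
  "cube n = {x. \<forall>i. x $ i \<in> {- int n..int n}}"

definition zero_config :: "'d::finite config" where
  "zero_config = (\<lambda>_. False)"

definition translate :: "'d::finite site \<Rightarrow> 'd config \<Rightarrow> 'd config" where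
  "translate x \<eta> = (\<lambda>z. \<eta> (z + x))"

definition Omega_measure :: "('d::finite site \<Rightarrow> real) measure" where
  "Omega_measure = (\<Pi>\<^sub>M x\<in>UNIV. restrict_space lborel {0<..<1})"

text \<open>
  Elements of \<open>{0,1}\<close> to the power \<open>cube \<nu>\<close> are extensional functions, that is, functions
  on all sites which take the value \<open>undefined\<close> outside \<open>cube \<nu>\<close>.
\<close>

definition parking_scheme :: "nat \<Rightarrow> 'd::finite config set \<Rightarrow> bool" where
  "parking_scheme \<nu> S \<longleftrightarrow>
     S \<subseteq> (cube \<nu> \<rightarrow>\<^sub>E UNIV) \<and> restrict zero_config (cube \<nu>) \<in> S"

definition park_visit ::
  "nat \<Rightarrow> 'd::finite config set \<Rightarrow> 'd site \<Rightarrow> 'd config \<Rightarrow> 'd config" where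
  "park_visit \<nu> S x \<eta> =
     (if restrict (translate x \<eta>) (cube \<nu>) \<in> S then \<eta>(x := True) else \<eta>)"

text \<open>
  The jamming limit \<open>P\<^sub>X(\<omega>)\<close>. It is meaningful only for finite \<open>X\<close> and \<open>\<omega>\<close> injective on \<open>X\<close>;
  \<open>visiting_order\<close> below shows that in this case each site of \<open>X\<close> is visited exactly once,
  in increasing order of \<open>\<omega>\<close>.
\<close>

definition jamming_limit ::
  "nat \<Rightarrow> 'd::finite config set \<Rightarrow> 'd site set \<Rightarrow> ('d site \<Rightarrow> real) \<Rightarrow> 'd config" where
  "jamming_limit \<nu> S X \<omega> = fold (park_visit \<nu> S) (sorted_key_list_of_set \<omega> X) zero_config"

lemma visiting_order:
  fixes \<omega> :: "'d::finite site \<Rightarrow> real"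
  assumes "finite X" "inj_on \<omega> X"
  shows "set (sorted_key_list_of_set \<omega> X) = X"
    and "distinct (sorted_key_list_of_set \<omega> X)"
    and "sorted_wrt (<) (map \<omega> (sorted_key_list_of_set \<omega> X))"
proof -
  interpret folding_on X "insort_key \<omega>" "[]"
    rewrites "folding_on.F (insort_key \<omega>) [] = sorted_key_list_of_set \<omega>"
  proof -
    have "insort_key \<omega> y (insort_key \<omega> x xs) = insort_key \<omega> x (insort_key \<omega> y xs)"
      if "x \<in> X" "y \<in> X" for x y xs
      using that assms(2) by (induction xs) (auto simp: inj_onD)
    then show "folding_on X (insort_key \<omega>)"
      by unfold_locales (simp add: fun_eq_iff)
  qed (simp add: sorted_key_list_of_set_def)
  let ?l = "sorted_key_list_of_set \<omega>"
  have *: "set (?l A) = A \<and> distinct (?l A) \<and> sorted (map \<omega> (?l A))"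
    if "finite A" "A \<subseteq> X" for A
    using that
  proof (induction A rule: finite_induct)
    case (insert x A)
    then show ?case
      by (simp add: set_insort_key distinct_insort_key sorted_insort_key)
         (simp add: distinct_insort)
  qed simp
  show 1: "set (?l X) = X" and 2: "distinct (?l X)"
    using *[OF assms(1) subset_refl] by auto
  have "distinct (map \<omega> (?l X))"
    using 1 2 assms(2) by (simp add: distinct_map)
  then show "sorted_wrt (<) (map \<omega> (?l X))"
    using *[OF assms(1) subset_refl] by (simp add: strict_sorted_iff)
qed

definition lattice_path :: "nat \<Rightarrow> 'd::finite site list \<Rightarrow> bool" where
  "lattice_path \<nu> xs \<longleftrightarrow>
     xs \<noteq> [] \<and> (\<forall>i. Suc i < length xs \<longrightarrow> sup_norm (xs ! Suc i - xs ! i) \<le> int \<nu>)"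

definition decreasing_path ::
  "nat \<Rightarrow> ('d::finite site \<Rightarrow> real) \<Rightarrow> 'd site list \<Rightarrow> bool" where
  "decreasing_path \<nu> \<omega> xs \<longleftrightarrow> lattice_path \<nu> xs \<and> sorted_wrt (>) (map \<omega> xs)"

text \<open>The relation \<open>y \<up>\<^sub>\<omega> x\<close>; note that the path runs from \<open>x\<close> down to \<open>y\<close>.\<close>

definition path_up ::
  "nat \<Rightarrow> ('d::finite site \<Rightarrow> real) \<Rightarrow> 'd site \<Rightarrow> 'd site \<Rightarrow> bool" where
  "path_up \<nu> \<omega> y x \<longleftrightarrow> (\<exists>xs. decreasing_path \<nu> \<omega> xs \<and> hd xs = x \<and> last xs = y)"

definition armour ::
  "nat \<Rightarrow> 'd::finite site set \<Rightarrow> ('d site \<Rightarrow> real) \<Rightarrow> 'd site set" where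
  "armour \<nu> X \<omega> = {y. \<exists>x\<in>X. path_up \<nu> \<omega> y x}"

definition infinite_decreasing_path ::
  "nat \<Rightarrow> ('d::finite site \<Rightarrow> real) \<Rightarrow> (nat \<Rightarrow> 'd site) \<Rightarrow> bool" where
  "infinite_decreasing_path \<nu> \<omega> x \<longleftrightarrow>
     (\<forall>i. sup_norm (x (Suc i) - x i) \<le> int \<nu> \<and> \<omega> (x i) > \<omega> (x (Suc i)))"

definition exceptional :: "nat \<Rightarrow> ('d::finite site \<Rightarrow> real) \<Rightarrow> bool" where
  "exceptional \<nu> \<omega> \<longleftrightarrow> \<not> inj \<omega> \<or> (\<exists>x. infinite_decreasing_path \<nu> \<omega> x)"

definition parking_cube ::
  "nat \<Rightarrow> 'd::finite config set \<Rightarrow> nat \<Rightarrow> ('d site \<Rightarrow> real) \<Rightarrow> 'd config" where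
  "parking_cube \<nu> S n \<omega> =
     (if exceptional \<nu> \<omega> then zero_config else jamming_limit \<nu> S (cube n) \<omega>)"

definition limit_algorithm ::
  "nat \<Rightarrow> 'd::finite config set \<Rightarrow> ('d site \<Rightarrow> real) \<Rightarrow> 'd config" where
  "limit_algorithm \<nu> S \<omega> =
     (if exceptional \<nu> \<omega> then zero_config
      else (\<lambda>x. jamming_limit \<nu> S (armour \<nu> {x} \<omega>) \<omega> x))"

definition occupation_density ::
  "nat \<Rightarrow> 'd::finite config set \<Rightarrow> nat \<Rightarrow> ('d site \<Rightarrow> real) \<Rightarrow> real" where
  "occupation_density \<nu> S n \<omega> =
     (\<Sum>x\<in>cube n. of_bool (parking_cube \<nu> S n \<omega> x)) / (2 * real n + 1) ^ CARD('d)"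

definition limit_density :: "nat \<Rightarrow> 'd::finite config set \<Rightarrow> real" where
  "limit_density \<nu> S = (\<integral>\<omega>. of_bool (limit_algorithm \<nu> S \<omega> 0) \<partial>Omega_measure)"

end

theory Submission
  imports Defs "HOL-Combinatorics.Permutations" "HOL-Library.Discrete_Functions"
    "HOL-Real_Asymp.Real_Asymp"
begin

text \<open>
  Whether a site is parked depends only on the sites reached from it by decreasing paths, and long
  decreasing paths are rare: a path with \<open>k\<close> steps is decreasing with probability at most
  \<open>1 / fact (Suc k)\<close>, whereas only exponentially many paths with \<open>k\<close> steps start at a site
  (\<open>prob_descends_tendsto_0\<close>). In particular almost every labelling is unexceptional.

  Let \<open>Q k\<close> be the configuration obtained by applying the parking rule \<open>k\<close> times to the empty
  configuration (\<open>iterated_parking\<close>). It is a stationary field of finite range. At a site from which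
  no decreasing path with \<open>k\<close> steps starts it agrees with the limit algorithm, and also with the
  parking process on \<open>cube n\<close> unless the site lies within distance \<open>k * \<nu>\<close> of the boundary
  (\<open>jamming_limit_eq_iterated_parking\<close>). Hence, almost surely, the occupation density differs from
  the average of \<open>Q k\<close> over \<open>cube n\<close> by at most the frequency of starts of decreasing paths with \<open>k\<close>
  steps plus the proportion of the boundary layer (\<open>occupation_density_approx\<close>).

  Both the occupation by \<open>Q k\<close> and the start of such a path are local events, to which a strong law
  of large numbers for stationary fields of finite range applies
  (\<open>AE_cube_average_tendsto_expectation\<close>): distant sites are independent, so the second moments of
  the centred averages are summable along the squares, and monotonicity of the sums fills the gaps.
  Letting \<open>n\<close> tend to infinity leaves an error of twice the probability \<open>p k\<close> that a decreasing path
  with \<open>k\<close> steps starts at the origin, once for the average and once for the expectation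
  (\<open>limit_density_approx\<close>); then \<open>k\<close> tends to infinity.
\<close>

section \<open>Local description of the parking process\<close>

lemma finite_cube: "finite (cube n :: 'd::finite site set)"
proof -
  have "(cube n :: 'd site set) \<subseteq> vec_lambda ` (UNIV \<rightarrow>\<^sub>E {- int n..int n})"
  proof
    fix x :: "'d site" assume "x \<in> cube n"
    then have "x = vec_lambda (\<lambda>i. x $ i)" "(\<lambda>i. x $ i) \<in> UNIV \<rightarrow>\<^sub>E {- int n..int n}"
      by (auto simp: cube_def)
    then show "x \<in> vec_lambda ` (UNIV \<rightarrow>\<^sub>E {- int n..int n})" by blast
  qed
  then show ?thesis
    by (rule finite_subset) (intro finite_imageI finite_PiE; simp)
qed

lemma card_cube: "card (cube n :: 'd::finite site set) = (2 * n + 1) ^ CARD('d)"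
proof -
  have "bij_betw vec_lambda (UNIV \<rightarrow>\<^sub>E {- int n..int n}) (cube n :: 'd site set)"
    by (rule bij_betw_byWitness[where f' = vec_nth]) (auto simp: cube_def)
  then have "card (cube n :: 'd site set) = card ((UNIV :: 'd set) \<rightarrow>\<^sub>E {- int n..int n})"
    by (simp add: bij_betw_same_card)
  also have "\<dots> = nat (2 * int n + 1) ^ CARD('d)"
    by (simp add: card_PiE prod_constant algebra_simps)
  also have "nat (2 * int n + 1) = 2 * n + 1" by simp
  finally show ?thesis .
qed

lemma mem_cube_iff: "x \<in> cube n \<longleftrightarrow> (\<forall>i. - int n \<le> x $ i \<and> x $ i \<le> int n)"
  by (simp add: cube_def)

lemma cube_mono: "m \<le> n \<Longrightarrow> cube m \<subseteq> (cube n :: 'd::finite site set)"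
proof
  fix x :: "'d site" assume "m \<le> n" "x \<in> cube m"
  then show "x \<in> cube n"
    unfolding mem_cube_iff by (meson neg_le_iff_le of_nat_mono order_trans)
qed

lemma cube_add:
  assumes "x \<in> cube m" "y \<in> cube n"
  shows "x + y \<in> cube (m + n)"
  unfolding mem_cube_iff
proof
  fix i
  have "- int m \<le> x $ i \<and> x $ i \<le> int m" "- int n \<le> y $ i \<and> y $ i \<le> int n"
    using assms by (simp_all add: mem_cube_iff)
  then show "- int (m + n) \<le> (x + y) $ i \<and> (x + y) $ i \<le> int (m + n)"
    by simp
qed

lemma cube_uminus: "x \<in> cube n \<Longrightarrow> - x \<in> cube n"
  by (auto simp: mem_cube_iff minus_le_iff)

lemma zero_in_cube: "0 \<in> cube n"
  by (simp add: cube_def)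

lemma sup_norm_le_iff: "sup_norm x \<le> int n \<longleftrightarrow> x \<in> cube n"
  by (auto simp: sup_norm_def cube_def abs_le_iff minus_le_iff)

lemma fold_park_visit_unvisited:
  "x \<notin> set xs \<Longrightarrow> fold (park_visit \<nu> S) xs \<eta> x = \<eta> x"
  by (induction xs arbitrary: \<eta>) (auto simp: park_visit_def)

text \<open>
  The configuration met when \<open>x\<close> is visited is the final one restricted to labels below that of
  \<open>x\<close>: a site keeps the value decided at its only visit, and sites not yet visited are empty. The
  jamming limit is thereby a fixed point of a rule that mentions no order of visits.
\<close>

lemma jamming_limit_iff:
  fixes \<omega> :: "'d::finite site \<Rightarrow> real"
  assumes X: "finite X" "inj_on \<omega> X" and "x \<in> X"
  shows "jamming_limit \<nu> S X \<omega> x \<longleftrightarrow>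
    restrict (translate x (\<lambda>y. jamming_limit \<nu> S X \<omega> y \<and> \<omega> y < \<omega> x)) (cube \<nu>) \<in> S"
proof -
  let ?l = "sorted_key_list_of_set \<omega> X" and ?f = "fold (park_visit \<nu> S)"
  have l: "set ?l = X" "distinct ?l" "sorted_wrt (<) (map \<omega> ?l)"
    using visiting_order[OF X] by auto
  obtain as bs where ab: "?l = as @ x # bs"
    using split_list[of x ?l] l(1) \<open>x \<in> X\<close> by auto
  have x: "x \<notin> set as" "x \<notin> set bs"
    using l(2) ab by auto
  have less: "\<omega> a < \<omega> x" if "a \<in> set as" for a
    using l(3) that by (auto simp: ab sorted_wrt_append)
  have more: "\<omega> x < \<omega> b" if "b \<in> set bs" for b
    using l(3) that by (auto simp: ab sorted_wrt_append)
  have final: "jamming_limit \<nu> S X \<omega> = ?f bs (park_visit \<nu> S x (?f as zero_config))"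
    by (simp add: jamming_limit_def ab)
  have at_x: "jamming_limit \<nu> S X \<omega> x \<longleftrightarrow>
      restrict (translate x (?f as zero_config)) (cube \<nu>) \<in> S"
    using x by (auto simp: final fold_park_visit_unvisited park_visit_def zero_config_def)
  have "?f as zero_config y \<longleftrightarrow> jamming_limit \<nu> S X \<omega> y \<and> \<omega> y < \<omega> x" for y
  proof (cases "y \<in> set as")
    case True
    then have "y \<notin> set bs" "y \<noteq> x"
      using l(2) ab by auto
    then have "jamming_limit \<nu> S X \<omega> y = ?f as zero_config y"
      by (simp add: final fold_park_visit_unvisited park_visit_def)
    then show ?thesis
      using less[OF True] by simp
  next
    case False
    then have "\<not> ?f as zero_config y"
      by (simp add: fold_park_visit_unvisited zero_config_def)
    moreover have "\<not> jamming_limit \<nu> S X \<omega> y" if "\<omega> y < \<omega> x"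
    proof -
      have "y \<notin> set ?l"
        using that False more[of y] by (auto simp: ab)
      then show ?thesis
        by (simp add: jamming_limit_def fold_park_visit_unvisited zero_config_def)
    qed
    ultimately show ?thesis by blast
  qed
  then have "?f as zero_config = (\<lambda>y. jamming_limit \<nu> S X \<omega> y \<and> \<omega> y < \<omega> x)"
    by blast
  then show ?thesis
    using at_x by simp
qed

text \<open>
  The fixed-point rule iterated from the empty configuration. The \<open>k\<close>-th iterate looks only at the
  labels within distance \<open>k * \<nu>\<close>, which makes it accessible to a law of large numbers for fields
  of finite range.
\<close>

primrec iterated_parking ::
  "nat \<Rightarrow> 'd::finite config set \<Rightarrow> nat \<Rightarrow> ('d site \<Rightarrow> real) \<Rightarrow> 'd config" where
  "iterated_parking \<nu> S 0 \<omega> = zero_config"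
| "iterated_parking \<nu> S (Suc k) \<omega> =
     (\<lambda>x. restrict (translate x (\<lambda>y. iterated_parking \<nu> S k \<omega> y \<and> \<omega> y < \<omega> x)) (cube \<nu>) \<in> S)"

text \<open>
  Recursion on the length replaces lists of sites, because every argument about decreasing paths
  peels off the first step.
\<close>

primrec descends :: "nat \<Rightarrow> nat \<Rightarrow> ('d::finite site \<Rightarrow> real) \<Rightarrow> 'd site \<Rightarrow> bool" where
  "descends \<nu> 0 \<omega> x \<longleftrightarrow> True"
| "descends \<nu> (Suc k) \<omega> x \<longleftrightarrow> (\<exists>z\<in>cube \<nu>. \<omega> (z + x) < \<omega> x \<and> descends \<nu> k \<omega> (z + x))"

lemma descends_Suc_imp: "descends \<nu> (Suc k) \<omega> x \<Longrightarrow> descends \<nu> k \<omega> x"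
proof (induction k arbitrary: x)
  case (Suc k)
  then show ?case by (metis descends.simps(2))
qed simp

lemma descends_antimono: "k \<le> l \<Longrightarrow> descends \<nu> l \<omega> x \<Longrightarrow> descends \<nu> k \<omega> x"
proof (induction l rule: dec_induct)
  case (step l)
  then show ?case using descends_Suc_imp by blast
qed

lemma path_up_step:
  assumes "path_up \<nu> \<omega> y (z + x)" "z \<in> cube \<nu>" "\<omega> (z + x) < \<omega> x"
  shows "path_up \<nu> \<omega> y x"
proof -
  obtain xs where xs: "decreasing_path \<nu> \<omega> xs" "hd xs = z + x" "last xs = y"
    using assms(1) by (auto simp: path_up_def)
  then obtain ys where ys: "xs = (z + x) # ys"
    by (cases xs) (auto simp: decreasing_path_def lattice_path_def)
  have "lattice_path \<nu> (x # xs)"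
    using xs(1) assms(2) unfolding decreasing_path_def lattice_path_def
    by (auto simp: ys nth_Cons sup_norm_le_iff split: nat.splits)
  moreover have "sorted_wrt (>) (map \<omega> (x # xs))"
    using xs(1) assms(3) by (auto simp: decreasing_path_def ys)
  ultimately have "decreasing_path \<nu> \<omega> (x # xs)"
    by (simp add: decreasing_path_def)
  then show ?thesis
    using xs(3) ys unfolding path_up_def by (intro exI[of _ "x # xs"]) auto
qed

lemma path_up_cases:
  assumes "path_up \<nu> \<omega> y x"
  obtains "y = x" | z where "z \<in> cube \<nu>" "\<omega> (z + x) < \<omega> x" "path_up \<nu> \<omega> y (z + x)"
proof -
  obtain xs where xs: "decreasing_path \<nu> \<omega> xs" "hd xs = x" "last xs = y"
    using assms by (auto simp: path_up_def)
  then obtain ys where ys: "xs = x # ys"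
    by (cases xs) (auto simp: decreasing_path_def lattice_path_def)
  show thesis
  proof (cases ys)
    case Nil
    then show thesis using xs ys that(1) by simp
  next
    case (Cons a as)
    have "lattice_path \<nu> ys"
      using xs(1) unfolding decreasing_path_def lattice_path_def ys Cons by force
    then have "decreasing_path \<nu> \<omega> ys"
      using xs(1) by (auto simp: decreasing_path_def ys)
    moreover have "sup_norm (a - x) \<le> int \<nu>"
      using xs(1) unfolding decreasing_path_def lattice_path_def ys Cons by force
    moreover have "\<omega> a < \<omega> x"
      using xs(1) by (auto simp: decreasing_path_def ys Cons)
    ultimately show thesis
      using xs(3) ys Cons
      by (intro that(2)[of "a - x"]) (auto simp: sup_norm_le_iff path_up_def)
  qed
qed

lemma armour_singleton:
  "armour \<nu> {x} \<omega> = insert x (\<Union>z\<in>{z\<in>cube \<nu>. \<omega> (z + x) < \<omega> x}. armour \<nu> {z + x} \<omega>)"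
proof -
  have "path_up \<nu> \<omega> x x"
    unfolding path_up_def decreasing_path_def lattice_path_def
    by (intro exI[of _ "[x]"]) simp
  then show ?thesis
    by (auto simp: armour_def elim: path_up_cases intro: path_up_step)
qed

text \<open>
  A bound on the length of decreasing paths confines the armour; in particular the armour is finite,
  so that the parking process on it is meaningful.
\<close>

lemma armour_subset_cube:
  assumes "\<not> descends \<nu> k \<omega> x"
  shows "armour \<nu> {x} \<omega> \<subseteq> (\<lambda>z. z + x) ` cube (k * \<nu>)"
  using assms
proof (induction k arbitrary: x)
  case (Suc k)
  show ?case
  proof
    fix y assume "y \<in> armour \<nu> {x} \<omega>"
    then consider "y = x"
      | z where "z \<in> cube \<nu>" "\<omega> (z + x) < \<omega> x" "y \<in> armour \<nu> {z + x} \<omega>"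
      by (subst (asm) armour_singleton) auto
    then show "y \<in> (\<lambda>z. z + x) ` cube (Suc k * \<nu>)"
    proof cases
      case 1
      then show ?thesis using zero_in_cube by force
    next
      case (2 z)
      then obtain w where w: "w \<in> cube (k * \<nu>)" "y = w + (z + x)"
        using Suc by fastforce
      then have "y = (z + w) + x" "z + w \<in> cube (Suc k * \<nu>)"
        using cube_add[OF 2(1) w(1)] by (auto simp: algebra_simps)
      then show ?thesis by blast
    qed
  qed
qed simp

text \<open>
  Unfolding the decision rule along decreasing paths: once every decreasing path from \<open>x\<close> has
  fewer than \<open>k\<close> steps, the recursion has bottomed out, and only sites of the armour have been
  consulted, so that the set \<open>X\<close> on which the process runs is immaterial.
\<close>

lemma jamming_limit_eq_iterated_parking:
  fixes \<omega> :: "'d::finite site \<Rightarrow> real"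
  assumes X: "finite X" "inj_on \<omega> X"
    and "\<not> descends \<nu> k \<omega> x" "armour \<nu> {x} \<omega> \<subseteq> X"
  shows "jamming_limit \<nu> S X \<omega> x = iterated_parking \<nu> S k \<omega> x"
  using assms(3,4)
proof (induction k arbitrary: x)
  case (Suc k)
  have sub: "x \<in> X" "\<And>z. z \<in> cube \<nu> \<Longrightarrow> \<omega> (z + x) < \<omega> x \<Longrightarrow> armour \<nu> {z + x} \<omega> \<subseteq> X"
    using Suc.prems(2) by (subst (asm) armour_singleton; blast)+
  have "jamming_limit \<nu> S X \<omega> (z + x) = iterated_parking \<nu> S k \<omega> (z + x)"
    if "z \<in> cube \<nu>" "\<omega> (z + x) < \<omega> x" for z
    using Suc.prems(1) that by (intro Suc.IH sub) auto
  then have "restrict (translate x (\<lambda>y. jamming_limit \<nu> S X \<omega> y \<and> \<omega> y < \<omega> x)) (cube \<nu>) =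
      restrict (translate x (\<lambda>y. iterated_parking \<nu> S k \<omega> y \<and> \<omega> y < \<omega> x)) (cube \<nu>)"
    by (auto simp: translate_def restrict_def fun_eq_iff)
  then show ?case
    by (simp add: jamming_limit_iff[OF X sub(1)])
qed simp

text \<open>
  Koenig's lemma for the descent tree, whose branching is bounded by the size of the cube.
\<close>

lemma infinite_decreasing_path_iff:
  fixes \<omega> :: "'d::finite site \<Rightarrow> real"
  shows "(\<exists>p. infinite_decreasing_path \<nu> \<omega> p) \<longleftrightarrow> (\<exists>x. \<forall>k. descends \<nu> k \<omega> x)"
proof
  assume "\<exists>p. infinite_decreasing_path \<nu> \<omega> p"
  then obtain p where p: "infinite_decreasing_path \<nu> \<omega> p" ..
  have "descends \<nu> k \<omega> (p i)" for k i
  proof (induction k arbitrary: i)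
    case (Suc k)
    have "p (Suc i) - p i \<in> cube \<nu>" "\<omega> (p (Suc i)) < \<omega> (p i)"
      using p by (auto simp: infinite_decreasing_path_def sup_norm_le_iff)
    then show ?case
      using Suc by (auto intro!: bexI[of _ "p (Suc i) - p i"])
  qed simp
  then show "\<exists>x. \<forall>k. descends \<nu> k \<omega> x" by blast
next
  assume "\<exists>x. \<forall>k. descends \<nu> k \<omega> x"
  then obtain x0 where x0: "\<forall>k. descends \<nu> k \<omega> x0" ..
  \<comment> \<open>If each lower neighbour failed at some depth, then \<open>x\<close> would fail at one more than the sum
    of these depths.\<close>
  have step: "\<exists>y. (\<forall>k. descends \<nu> k \<omega> y) \<and> y - x \<in> cube \<nu> \<and> \<omega> y < \<omega> x"
    if x: "\<forall>k. descends \<nu> k \<omega> x" for x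
  proof (rule ccontr)
    assume contra: "\<not> ?thesis"
    define N where "N = {z \<in> cube \<nu>. \<omega> (z + x) < \<omega> x}"
    have "\<forall>z\<in>N. \<exists>k. \<not> descends \<nu> k \<omega> (z + x)"
      using contra by (auto simp: N_def) (metis add_diff_cancel_right')
    then obtain K where K: "\<And>z. z \<in> N \<Longrightarrow> \<not> descends \<nu> (K z) \<omega> (z + x)"
      by metis
    have "finite N" by (simp add: N_def finite_cube)
    have "descends \<nu> (Suc (\<Sum>z\<in>N. K z)) \<omega> x" using x by blast
    then obtain z where z: "z \<in> N" "descends \<nu> (\<Sum>z\<in>N. K z) \<omega> (z + x)"
      by (auto simp: N_def)
    have "K z \<le> (\<Sum>z\<in>N. K z)"
      using z(1) \<open>finite N\<close> by (meson member_le_sum zero_le)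
    then show False
      using K[OF z(1)] z(2) descends_antimono by blast
  qed
  obtain p where "\<And>n. \<forall>k. descends \<nu> k \<omega> (p n)"
    "\<And>n. p (Suc n) - p n \<in> cube \<nu> \<and> \<omega> (p (Suc n)) < \<omega> (p n)"
    using dependent_nat_choice[of "\<lambda>_ x. \<forall>k. descends \<nu> k \<omega> x"
        "\<lambda>_ x y. y - x \<in> cube \<nu> \<and> \<omega> y < \<omega> x"] x0 step by metis
  then show "\<exists>p. infinite_decreasing_path \<nu> \<omega> p"
    by (auto simp: infinite_decreasing_path_def sup_norm_le_iff)
qed

lemma exceptional_iff:
  "exceptional \<nu> \<omega> \<longleftrightarrow> \<not> inj \<omega> \<or> (\<exists>x. \<forall>k. descends \<nu> k \<omega> x)"
  by (simp add: exceptional_def infinite_decreasing_path_iff)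

lemma limit_algorithm_eq_iterated_parking:
  assumes "\<not> exceptional \<nu> \<omega>" "\<not> descends \<nu> k \<omega> x"
  shows "limit_algorithm \<nu> S \<omega> x = iterated_parking \<nu> S k \<omega> x"
proof -
  have "finite (armour \<nu> {x} \<omega>)"
    using armour_subset_cube[OF assms(2)] finite_cube finite_subset by blast
  moreover have "inj_on \<omega> (armour \<nu> {x} \<omega>)"
    using assms(1) by (auto simp: exceptional_def intro: inj_on_subset)
  ultimately show ?thesis
    using assms by (simp add: limit_algorithm_def jamming_limit_eq_iterated_parking)
qed

text \<open>
  Away from the boundary layer of width \<open>k * \<nu>\<close> the armour stays inside the cube, so the null
  boundary condition is not felt.
\<close>

lemma parking_cube_eq_iterated_parking:
  assumes "\<not> exceptional \<nu> \<omega>" "\<not> descends \<nu> k \<omega> x" "x \<in> cube m" "m + k * \<nu> \<le> n"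
  shows "parking_cube \<nu> S n \<omega> x = iterated_parking \<nu> S k \<omega> x"
proof -
  have "armour \<nu> {x} \<omega> \<subseteq> cube (k * \<nu> + m)"
    using armour_subset_cube[OF assms(2)] cube_add[OF _ assms(3)] by fastforce
  also have "\<dots> \<subseteq> cube n"
    using assms(4) by (intro cube_mono) simp
  finally have "armour \<nu> {x} \<omega> \<subseteq> cube n" .
  moreover have "inj_on \<omega> (cube n)"
    using assms(1) by (auto simp: exceptional_def intro: inj_on_subset)
  ultimately show ?thesis
    using assms by (simp add: parking_cube_def jamming_limit_eq_iterated_parking finite_cube)
qed

text \<open>
  Translation covariance and finite range: what turns averages over a cube into averages of a
  stationary field of local functions.
\<close>

lemma iterated_parking_shift:
  "iterated_parking \<nu> S k (\<lambda>y. \<omega> (y + x)) z = iterated_parking \<nu> S k \<omega> (z + x)"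
  by (induction k arbitrary: z) (simp_all add: zero_config_def translate_def add.assoc)

lemma descends_shift:
  "descends \<nu> k (\<lambda>y. \<omega> (y + x)) z = descends \<nu> k \<omega> (z + x)"
  by (induction k arbitrary: z) (simp_all add: add.assoc)

lemma iterated_parking_cong:
  assumes "\<And>z. z \<in> cube (k * \<nu>) \<Longrightarrow> \<omega> (z + x) = \<omega>' (z + x)"
  shows "iterated_parking \<nu> S k \<omega> x = iterated_parking \<nu> S k \<omega>' x"
  using assms
proof (induction k arbitrary: x)
  case (Suc k)
  have x: "\<omega> x = \<omega>' x"
    using Suc.prems[of 0] by (simp add: zero_in_cube)
  have far: "\<omega> (w + (z + x)) = \<omega>' (w + (z + x))" if "z \<in> cube \<nu>" "w \<in> cube (k * \<nu>)" for z w
    using Suc.prems[of "z + w"] cube_add[OF that] by (simp add: algebra_simps)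
  have "\<omega> (z + x) = \<omega>' (z + x)" if "z \<in> cube \<nu>" for z
    using Suc.prems[of z] that cube_mono[of \<nu> "Suc k * \<nu>"] by auto
  moreover have "iterated_parking \<nu> S k \<omega> (z + x) = iterated_parking \<nu> S k \<omega>' (z + x)"
    if "z \<in> cube \<nu>" for z
    by (intro Suc.IH far that)
  ultimately have "restrict (translate x (\<lambda>y. iterated_parking \<nu> S k \<omega> y \<and> \<omega> y < \<omega> x)) (cube \<nu>) =
      restrict (translate x (\<lambda>y. iterated_parking \<nu> S k \<omega>' y \<and> \<omega>' y < \<omega>' x)) (cube \<nu>)"
    by (auto simp: translate_def restrict_def fun_eq_iff x)
  then show ?case by simp
qed simp

lemma descends_cong:
  assumes "\<And>z. z \<in> cube (k * \<nu>) \<Longrightarrow> \<omega> (z + x) = \<omega>' (z + x)"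
  shows "descends \<nu> k \<omega> x = descends \<nu> k \<omega>' x"
  using assms
proof (induction k arbitrary: x)
  case (Suc k)
  have x: "\<omega> x = \<omega>' x"
    using Suc.prems[of 0] by (simp add: zero_in_cube)
  have far: "\<omega> (w + (z + x)) = \<omega>' (w + (z + x))" if "z \<in> cube \<nu>" "w \<in> cube (k * \<nu>)" for z w
    using Suc.prems[of "z + w"] cube_add[OF that] by (simp add: algebra_simps)
  have "\<omega> (z + x) = \<omega>' (z + x)" if "z \<in> cube \<nu>" for z
    using Suc.prems[of z] that cube_mono[of \<nu> "Suc k * \<nu>"] by auto
  moreover have "descends \<nu> k \<omega> (z + x) = descends \<nu> k \<omega>' (z + x)" if "z \<in> cube \<nu>" for z
    by (intro Suc.IH far that)
  ultimately show ?case by (simp add: x)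
qed simp

section \<open>The label space\<close>

abbreviation uniform_label :: "real measure" where
  "uniform_label \<equiv> restrict_space lborel {0<..<1}"

lemma prob_space_uniform_label: "prob_space uniform_label"
  by (rule prob_spaceI) (simp add: emeasure_restrict_space space_restrict_space)

interpretation Omega: prob_space "Omega_measure :: ('d::finite site \<Rightarrow> real) measure"
  unfolding Omega_measure_def by (intro prob_space_PiM prob_space_uniform_label)

lemma measurable_label_uniform:
  "(\<lambda>\<omega>. \<omega> x) \<in> Omega_measure \<rightarrow>\<^sub>M uniform_label"
  unfolding Omega_measure_def by (rule measurable_component_singleton) simp

text \<open>
  The raw attribute keeps the rule from being closed under composition: the composed pattern
  \<open>\<lambda>\<omega>. g \<omega> x\<close> with unknown \<open>g\<close> matches every real function, and the measurability prover would
  loop.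
\<close>

lemma measurable_label [measurable (raw)]:
  "(\<lambda>\<omega>. \<omega> x) \<in> borel_measurable (Omega_measure :: ('d::finite site \<Rightarrow> real) measure)"
proof -
  have "(\<lambda>t. t) \<in> uniform_label \<rightarrow>\<^sub>M borel"
    by (intro measurable_restrict_space1) simp
  then show ?thesis
    using measurable_compose[OF measurable_label_uniform] by blast
qed

lemma space_Omega: "space Omega_measure = {\<omega>. \<forall>x. 0 < \<omega> x \<and> \<omega> x < 1}"
  by (auto simp: Omega_measure_def space_PiM space_restrict_space PiE_iff)

text \<open>
  Injective relabelling of the sites preserves the law. Translations give stationarity, finite
  permutations give the exchangeability behind the bound for long decreasing paths.
\<close>

lemma distr_Omega_reindex:
  fixes f :: "'d::finite site \<Rightarrow> 'd site"
  assumes "inj f"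
  shows "distr Omega_measure Omega_measure (\<lambda>\<omega> x. \<omega> (f x)) = Omega_measure"
  using distr_PiM_reindex[of UNIV "\<lambda>_. uniform_label" f UNIV] assms prob_space_uniform_label
  by (simp add: Omega_measure_def restrict_UNIV)

lemma measurable_Omega_reindex:
  "(\<lambda>\<omega> x. \<omega> (f x)) \<in> Omega_measure \<rightarrow>\<^sub>M Omega_measure"
  using measurable_label_uniform space_Omega unfolding Omega_measure_def
  by (intro measurable_PiM_single') (auto simp: space_restrict_space)

lemma measurable_Omega_shift [measurable (raw)]:
  "(\<lambda>\<omega> y. \<omega> (y + x)) \<in> Omega_measure \<rightarrow>\<^sub>M Omega_measure"
  by (rule measurable_Omega_reindex)

lemma inj_shift: "inj (\<lambda>y. y + x :: 'd::finite site)"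
  by (simp add: inj_def)

lemma integral_Omega_shift:
  fixes g :: "('d::finite site \<Rightarrow> real) \<Rightarrow> real"
  assumes "g \<in> borel_measurable Omega_measure"
  shows "(\<integral>\<omega>. g (\<lambda>y. \<omega> (y + x)) \<partial>Omega_measure) = (\<integral>\<omega>. g \<omega> \<partial>Omega_measure)"
  using integral_distr[OF measurable_Omega_reindex[of "\<lambda>y. y + x"] assms]
  by (simp add: distr_Omega_reindex[OF inj_shift])

lemma indep_labels: "Omega.indep_vars (\<lambda>_. uniform_label) (\<lambda>x \<omega>. \<omega> x) (UNIV :: 'd::finite site set)"
proof -
  have "distr Omega_measure uniform_label (\<lambda>\<omega>. \<omega> x) = uniform_label" for x :: "'d site"
    unfolding Omega_measure_def
    by (rule distr_PiM_component) (use prob_space_uniform_label in auto)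
  then show ?thesis
    by (subst Omega.indep_vars_iff_distr_eq_PiM)
      (auto simp: measurable_label_uniform restrict_UNIV distr_id2 simp flip: Omega_measure_def)
qed

lemma indep_restrict:
  fixes A B :: "'d::finite site set"
  assumes "A \<inter> B = {}"
  shows "Omega.indep_var (Pi\<^sub>M A (\<lambda>_. uniform_label)) (\<lambda>\<omega>. restrict \<omega> A)
           (Pi\<^sub>M B (\<lambda>_. uniform_label)) (\<lambda>\<omega>. restrict \<omega> B)"
  using Omega.indep_var_restrict[OF indep_labels assms] by simp

lemma integral_mult_disjoint_supports:
  fixes f g :: "('d::finite site \<Rightarrow> real) \<Rightarrow> real"
  assumes [measurable]: "f \<in> borel_measurable Omega_measure" "g \<in> borel_measurable Omega_measure"
    and int: "integrable Omega_measure f" "integrable Omega_measure g"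
    and f: "\<And>\<omega> \<omega>'. (\<And>z. z \<in> A \<Longrightarrow> \<omega> z = \<omega>' z) \<Longrightarrow> f \<omega> = f \<omega>'"
    and g: "\<And>\<omega> \<omega>'. (\<And>z. z \<in> B \<Longrightarrow> \<omega> z = \<omega>' z) \<Longrightarrow> g \<omega> = g \<omega>'"
    and "A \<inter> B = {}"
  shows "(\<integral>\<omega>. f \<omega> * g \<omega> \<partial>Omega_measure) =
    (\<integral>\<omega>. f \<omega> \<partial>Omega_measure) * (\<integral>\<omega>. g \<omega> \<partial>Omega_measure)"
proof -
  \<comment> \<open>Outside the support, any legitimate label will do; \<open>1/2\<close> is one.\<close>
  define ext :: "'d site set \<Rightarrow> ('d site \<Rightarrow> real) \<Rightarrow> 'd site \<Rightarrow> real"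
    where "ext = (\<lambda>C \<omega> z. if z \<in> C then \<omega> z else 1/2)"
  have ext [measurable]: "ext C \<in> Pi\<^sub>M C (\<lambda>_. uniform_label) \<rightarrow>\<^sub>M Omega_measure" for C
    unfolding ext_def Omega_measure_def
  proof (rule measurable_PiM_single')
    fix z :: "'d site"
    show "(\<lambda>\<omega>. if z \<in> C then \<omega> z else 1 / 2) \<in> Pi\<^sub>M C (\<lambda>_. uniform_label) \<rightarrow>\<^sub>M uniform_label"
      by (cases "z \<in> C")
        (auto simp: measurable_component_singleton space_restrict_space intro!: measurable_const)
  qed (auto simp: space_PiM space_restrict_space PiE_iff)
  have "Omega.indep_var borel ((f \<circ> ext A) \<circ> (\<lambda>\<omega>. restrict \<omega> A))
      borel ((g \<circ> ext B) \<circ> (\<lambda>\<omega>. restrict \<omega> B))"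
    by (intro Omega.indep_var_compose[OF indep_restrict[OF \<open>A \<inter> B = {}\<close>]]
        measurable_comp[OF ext] assms(1,2))
  moreover have "(f \<circ> ext A) \<circ> (\<lambda>\<omega>. restrict \<omega> A) = f" "(g \<circ> ext B) \<circ> (\<lambda>\<omega>. restrict \<omega> B) = g"
    unfolding fun_eq_iff comp_def by (intro allI f g; simp add: ext_def)+
  ultimately show ?thesis
    using Omega.indep_var_lebesgue_integral int by simp
qed

text \<open>Two labels are independent with diffuse law, so the diagonal is null by Fubini.\<close>

lemma AE_labels_distinct:
  fixes x y :: "'d::finite site"
  assumes "x \<noteq> y"
  shows "AE \<omega> in Omega_measure. \<omega> x \<noteq> \<omega> y"
proof -
  interpret U: prob_space uniform_label by (rule prob_space_uniform_label)
  interpret UU: pair_sigma_finite uniform_label uniform_label ..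
  let ?X = "(\<lambda>\<omega>. \<omega> x) \<circ> (\<lambda>\<omega>. restrict \<omega> {x})" and ?Y = "(\<lambda>\<omega>. \<omega> y) \<circ> (\<lambda>\<omega>. restrict \<omega> {y})"
  have "Omega.indep_var uniform_label ?X uniform_label ?Y"
    by (rule Omega.indep_var_compose[OF indep_restrict])
      (use assms in \<open>auto intro!: measurable_component_singleton\<close>)
  then have "Omega.indep_var uniform_label (\<lambda>\<omega>. \<omega> x) uniform_label (\<lambda>\<omega>. \<omega> y)"
    by (simp add: o_def)
  moreover have "distr Omega_measure uniform_label (\<lambda>\<omega>. \<omega> x) = uniform_label" for x :: "'d site"
    unfolding Omega_measure_def
    by (rule distr_PiM_component) (use prob_space_uniform_label in auto)
  ultimately have pair: "uniform_label \<Otimes>\<^sub>M uniform_label =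
      distr Omega_measure (uniform_label \<Otimes>\<^sub>M uniform_label) (\<lambda>\<omega>. (\<omega> x, \<omega> y))"
    by (simp add: Omega.indep_var_distribution_eq)
  have id: "(\<lambda>t. t) \<in> uniform_label \<rightarrow>\<^sub>M borel"
    by (intro measurable_restrict_space1) simp
  have proj: "fst \<in> borel_measurable (uniform_label \<Otimes>\<^sub>M uniform_label)"
      "snd \<in> borel_measurable (uniform_label \<Otimes>\<^sub>M uniform_label)"
    by (rule measurable_compose[OF measurable_fst id], rule measurable_compose[OF measurable_snd id])
  have "AE p in uniform_label \<Otimes>\<^sub>M uniform_label. fst p \<noteq> snd p"
  proof (rule UU.AE_pair_measure)
    have "AE b in uniform_label. a \<noteq> b" for a
      using AE_lborel_singleton[of a] by (subst AE_restrict_space_iff) auto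
    then show "AE a in uniform_label. AE b in uniform_label. fst (a, b) \<noteq> snd (a, b)"
      by simp
  qed (rule borel_measurable_neq[OF proj])
  then have "AE p in distr Omega_measure (uniform_label \<Otimes>\<^sub>M uniform_label) (\<lambda>\<omega>. (\<omega> x, \<omega> y)). fst p \<noteq> snd p"
    by (subst pair[symmetric])
  from AE_distrD[OF measurable_Pair[OF measurable_label_uniform measurable_label_uniform] this]
  show ?thesis by simp
qed

lemma AE_inj: "AE \<omega> in (Omega_measure :: ('d::finite site \<Rightarrow> real) measure). inj \<omega>"
proof -
  have "AE \<omega> in Omega_measure. fst p \<noteq> snd p \<longrightarrow> \<omega> (fst p) \<noteq> \<omega> (snd p)"
    for p :: "'d site \<times> 'd site"
    using AE_labels_distinct by (cases "fst p = snd p") auto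
  then have "AE \<omega> in Omega_measure.
      \<forall>p :: 'd site \<times> 'd site. fst p \<noteq> snd p \<longrightarrow> \<omega> (fst p) \<noteq> \<omega> (snd p)"
    by (subst AE_all_countable) blast
  then show ?thesis
    by (rule eventually_mono) (auto simp: inj_def)
qed

section \<open>Long decreasing paths\<close>

lemma pred_sorted_labels [measurable]:
  "Measurable.pred (Omega_measure :: ('d::finite site \<Rightarrow> real) measure)
     (\<lambda>\<omega>. sorted_wrt (>) (map (\<lambda>x. \<omega> (f x)) xs))"
  by (induction xs) simp_all

text \<open>
  For distinct sites, the events that the labels of \<open>xs\<close> are decreasing after one of the
  \<open>fact (length xs)\<close> permutations have the same probability by exchangeability, and they exclude
  one another.
\<close>

lemma prob_decreasing_le:
  fixes xs :: "'d::finite site list"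
  shows "Omega.prob {\<omega> \<in> space Omega_measure. sorted_wrt (>) (map \<omega> xs)} \<le> 1 / fact (length xs)"
proof (cases "distinct xs")
  case False
  have "{\<omega> \<in> space Omega_measure. sorted_wrt (>) (map \<omega> xs)} = {}"
  proof (rule ccontr)
    assume "\<not> ?thesis"
    then obtain \<omega> :: "'d site \<Rightarrow> real" where "sorted_wrt (>) (map \<omega> xs)" by blast
    then have "sorted_wrt (<) (rev (map \<omega> xs))" by (simp only: sorted_wrt_rev)
    then have "distinct (rev (map \<omega> xs))" using strict_sorted_iff by blast
    then show False using False by (simp add: distinct_map)
  qed
  then show ?thesis by (simp only: measure_empty) simp
next
  case True
  define E where "E p = {\<omega> \<in> space Omega_measure. sorted_wrt (>) (map (\<lambda>x. \<omega> (p x)) xs)}"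
    for p :: "'d site \<Rightarrow> 'd site"
  define P where "P = {p. p permutes set xs}"
  have [measurable]: "E p \<in> sets Omega_measure" for p
    unfolding E_def by measurable
  have "finite P" "card P = fact (length xs)"
    using True by (simp_all add: P_def finite_permutations card_permutations distinct_card)
  have prob_E: "Omega.prob (E p) = Omega.prob (E id)" if "p \<in> P" for p
  proof -
    have "inj p" using that by (simp add: P_def permutes_inj)
    have "Omega.prob (E id) = measure (distr Omega_measure Omega_measure (\<lambda>\<omega> x. \<omega> (p x))) (E id)"
      by (simp add: distr_Omega_reindex[OF \<open>inj p\<close>])
    also have "\<dots> = Omega.prob ((\<lambda>\<omega> x. \<omega> (p x)) -` E id \<inter> space Omega_measure)"
      by (rule measure_distr[OF measurable_Omega_reindex]) measurable
    also have "(\<lambda>\<omega> x. \<omega> (p x)) -` E id \<inter> space Omega_measure = E p"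
      by (auto simp: E_def space_Omega)
    finally show ?thesis by (rule sym)
  qed
  have "disjoint_family_on E P"
    unfolding disjoint_family_on_def
  proof (intro ballI impI, rule ccontr)
    fix p q assume pq: "p \<in> P" "q \<in> P" "p \<noteq> q" and "E p \<inter> E q \<noteq> {}"
    then obtain \<omega> where "\<omega> \<in> E p" "\<omega> \<in> E q" by blast
    then have sorted: "sorted_wrt (<) (rev (map (\<lambda>x. \<omega> (p x)) xs))"
        "sorted_wrt (<) (rev (map (\<lambda>x. \<omega> (q x)) xs))"
      unfolding E_def sorted_wrt_rev by auto
    have image: "p ` set xs = set xs" "q ` set xs = set xs"
      using pq by (simp_all add: P_def permutes_image)
    then have "(\<lambda>x. \<omega> (p x)) ` set xs = (\<lambda>x. \<omega> (q x)) ` set xs"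
      by (metis image_image)
    then have "map (\<lambda>x. \<omega> (p x)) xs = map (\<lambda>x. \<omega> (q x)) xs"
      using strict_sorted_equal[OF sorted] by auto
    then have eq: "\<omega> (p x) = \<omega> (q x)" if "x \<in> set xs" for x
      using that by simp
    have "distinct (map (\<lambda>x. \<omega> (p x)) xs)"
      using sorted(1) strict_sorted_iff distinct_rev by blast
    then have "inj_on (\<lambda>x. \<omega> (p x)) (set xs)"
      by (simp add: distinct_map)
    then have "inj_on \<omega> (p ` set xs)"
      by (auto simp: inj_on_def)
    then have inj: "inj_on \<omega> (set xs)" using image by simp
    have "p x = q x" for x
    proof (cases "x \<in> set xs")
      case True
      then have "p x \<in> set xs" "q x \<in> set xs" using image by blast+
      then show ?thesis using inj eq[OF True] by (simp add: inj_onD)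
    next
      case False
      then show ?thesis using pq by (simp add: P_def permutes_not_in)
    qed
    then show False using pq(3) by blast
  qed
  then have "Omega.prob (\<Union>p\<in>P. E p) = (\<Sum>p\<in>P. Omega.prob (E p))"
    using \<open>finite P\<close> by (intro Omega.finite_measure_finite_Union) auto
  also have "\<dots> = fact (length xs) * Omega.prob (E id)"
    using prob_E \<open>card P = _\<close> by simp
  finally have "fact (length xs) * Omega.prob (E id) \<le> 1"
    using Omega.prob_le_1 by metis
  then show ?thesis
    by (simp add: E_def field_simps)
qed

primrec descent_paths :: "nat \<Rightarrow> nat \<Rightarrow> 'd::finite site \<Rightarrow> 'd site list set" where
  "descent_paths \<nu> 0 x = {[x]}"
| "descent_paths \<nu> (Suc k) x = (\<Union>z\<in>cube \<nu>. (#) x ` descent_paths \<nu> k (z + x))"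

lemma length_descent_paths: "xs \<in> descent_paths \<nu> k x \<Longrightarrow> length xs = Suc k"
  by (induction k arbitrary: x xs) auto

lemma hd_descent_paths: "xs \<in> descent_paths \<nu> k x \<Longrightarrow> \<exists>ys. xs = x # ys"
  by (cases k) auto

lemma finite_descent_paths: "finite (descent_paths \<nu> k x)"
  by (induction k arbitrary: x) (auto simp: finite_cube)

lemma card_descent_paths_le:
  "card (descent_paths \<nu> k (x :: 'd::finite site)) \<le> card (cube \<nu> :: 'd site set) ^ k"
proof (induction k arbitrary: x)
  case (Suc k)
  have "card (descent_paths \<nu> (Suc k) x) \<le> (\<Sum>z\<in>(cube \<nu> :: 'd site set). card ((#) x ` descent_paths \<nu> k (z + x)))"
    unfolding descent_paths.simps by (rule card_UN_le) (rule finite_cube)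
  also have "\<dots> \<le> (\<Sum>z\<in>(cube \<nu> :: 'd site set). card (cube \<nu> :: 'd site set) ^ k)"
    using Suc by (intro sum_mono order_trans[OF card_image_le[OF finite_descent_paths]])
  finally show ?case by simp
qed simp

lemma descends_imp_decreasing:
  "descends \<nu> k \<omega> x \<Longrightarrow> \<exists>xs\<in>descent_paths \<nu> k x. sorted_wrt (>) (map \<omega> xs)"
proof (induction k arbitrary: x)
  case (Suc k)
  then obtain z where z: "z \<in> cube \<nu>" "\<omega> (z + x) < \<omega> x" "descends \<nu> k \<omega> (z + x)"
    by auto
  then obtain xs where xs: "xs \<in> descent_paths \<nu> k (z + x)" "sorted_wrt (>) (map \<omega> xs)"
    using Suc.IH by blast
  then obtain ys where "xs = (z + x) # ys"
    using hd_descent_paths by blast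
  then have "sorted_wrt (>) (map \<omega> (x # xs))"
    using xs(2) z(2) by auto
  moreover have "x # xs \<in> descent_paths \<nu> (Suc k) x"
    using xs(1) z(1) by auto
  ultimately show ?case by blast
qed simp

lemma pred_descends [measurable]:
  "Measurable.pred (Omega_measure :: ('d::finite site \<Rightarrow> real) measure) (\<lambda>\<omega>. descends \<nu> k \<omega> x)"
proof (induction k arbitrary: x)
  case (Suc k)
  note Suc [measurable]
  show ?case unfolding descends.simps by measurable
qed simp

text \<open>
  The union bound: exponentially many paths, each decreasing with factorially small probability.
\<close>

lemma prob_descends_le:
  fixes x :: "'d::finite site"
  shows "Omega.prob {\<omega> \<in> space Omega_measure. descends \<nu> k \<omega> x} \<le>
    real (card (cube \<nu> :: 'd site set)) ^ k / fact (Suc k)"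
proof -
  let ?E = "\<lambda>xs. {\<omega> \<in> space Omega_measure. sorted_wrt (>) (map \<omega> xs)}"
  have E: "?E xs \<in> sets Omega_measure" for xs :: "'d site list"
    using pred_sorted_labels[of "\<lambda>x. x" xs] by measurable
  have "{\<omega> \<in> space Omega_measure. descends \<nu> k \<omega> x} \<subseteq> (\<Union>xs\<in>descent_paths \<nu> k x. ?E xs)"
    using descends_imp_decreasing by blast
  then have "Omega.prob {\<omega> \<in> space Omega_measure. descends \<nu> k \<omega> x} \<le>
      Omega.prob (\<Union>xs\<in>descent_paths \<nu> k x. ?E xs)"
    by (intro Omega.finite_measure_mono sets.finite_UN finite_descent_paths E)
  also have "\<dots> \<le> (\<Sum>xs\<in>descent_paths \<nu> k x. Omega.prob (?E xs))"
    using E by (intro Omega.finite_measure_subadditive_finite finite_descent_paths) auto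
  also have "\<dots> \<le> (\<Sum>xs\<in>descent_paths \<nu> k x. 1 / fact (Suc k))"
  proof (rule sum_mono)
    fix xs assume "xs \<in> descent_paths \<nu> k x"
    then show "Omega.prob (?E xs) \<le> 1 / fact (Suc k)"
      using prob_decreasing_le[of xs] by (simp only: length_descent_paths)
  qed
  also have "\<dots> = real (card (descent_paths \<nu> k x)) / fact (Suc k)"
    by simp
  also have "\<dots> \<le> real (card (cube \<nu> :: 'd site set)) ^ k / fact (Suc k)"
    using card_descent_paths_le[of \<nu> k x] by (intro divide_right_mono) (simp_all flip: of_nat_power)
  finally show ?thesis .
qed

lemma prob_descends_tendsto_0:
  fixes x :: "'d::finite site"
  shows "(\<lambda>k. Omega.prob {\<omega> \<in> space Omega_measure. descends \<nu> k \<omega> x}) \<longlonglongrightarrow> 0"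
proof (rule tendsto_sandwich[OF _ _ tendsto_const])
  define M where "M = real (card (cube \<nu> :: 'd site set))"
  show "(\<lambda>k. inverse (fact k) * M ^ k) \<longlonglongrightarrow> 0"
    using summable_exp[of M] by (rule summable_LIMSEQ_zero)
  have "Omega.prob {\<omega> \<in> space Omega_measure. descends \<nu> k \<omega> x} \<le> inverse (fact k) * M ^ k" for k
  proof -
    have "M ^ k / fact (Suc k) \<le> M ^ k / fact k"
      by (intro divide_left_mono fact_mono) (auto simp: M_def)
    also have "M ^ k / fact k = inverse (fact k) * M ^ k"
      by (simp add: field_simps)
    finally show ?thesis
      using order_trans[OF prob_descends_le[of \<nu> k x]] by (simp add: M_def)
  qed
  then show "\<forall>\<^sub>F k in sequentially.
      Omega.prob {\<omega> \<in> space Omega_measure. descends \<nu> k \<omega> x} \<le> inverse (fact k) * M ^ k"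
    by simp
qed simp

lemma AE_not_exceptional:
  "AE \<omega> in (Omega_measure :: ('d::finite site \<Rightarrow> real) measure). \<not> exceptional \<nu> \<omega>"
proof -
  have "AE \<omega> in Omega_measure. \<not> (\<forall>k. descends \<nu> k \<omega> x)" for x :: "'d site"
  proof (rule AE_I)
    let ?N = "{\<omega> \<in> space Omega_measure. \<forall>k. descends \<nu> k \<omega> x}"
    show "?N \<in> sets Omega_measure" by measurable
    have "Omega.prob ?N \<le> Omega.prob {\<omega> \<in> space Omega_measure. descends \<nu> k \<omega> x}" for k
      by (intro Omega.finite_measure_mono) auto
    then have "Omega.prob ?N \<le> 0"
      using LIMSEQ_le_const[OF prob_descends_tendsto_0] by blast
    then show "emeasure Omega_measure ?N = 0"
      by (simp add: Omega.emeasure_eq_measure measure_le_0_iff)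
  qed auto
  then have "AE \<omega> in Omega_measure. \<forall>x :: 'd site. \<not> (\<forall>k. descends \<nu> k \<omega> x)"
    by (subst AE_all_countable) blast
  with AE_inj show ?thesis
    by eventually_elim (simp add: exceptional_iff)
qed

section \<open>A strong law of large numbers for fields of finite range\<close>

text \<open>
  The sum of the squares has finite expectation, hence is almost surely finite, and the terms of a
  convergent series vanish in the limit.
\<close>

lemma (in prob_space) AE_tendsto_0_if_summable_second_moments:
  fixes X :: "nat \<Rightarrow> 'a \<Rightarrow> real"
  assumes [measurable]: "\<And>n. X n \<in> borel_measurable M"
    and int: "\<And>n. integrable M (\<lambda>\<omega>. (X n \<omega>)\<^sup>2)"
    and sum: "summable (\<lambda>n. expectation (\<lambda>\<omega>. (X n \<omega>)\<^sup>2))"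
  shows "AE \<omega> in M. (\<lambda>n. X n \<omega>) \<longlonglongrightarrow> 0"
proof -
  have "(\<integral>\<^sup>+\<omega>. (\<Sum>n. ennreal ((X n \<omega>)\<^sup>2)) \<partial>M) = (\<Sum>n. \<integral>\<^sup>+\<omega>. ennreal ((X n \<omega>)\<^sup>2) \<partial>M)"
    by (intro nn_integral_suminf) measurable
  also have "\<dots> = (\<Sum>n. ennreal (expectation (\<lambda>\<omega>. (X n \<omega>)\<^sup>2)))"
    by (intro suminf_cong nn_integral_eq_integral int) auto
  also have "\<dots> = ennreal (\<Sum>n. expectation (\<lambda>\<omega>. (X n \<omega>)\<^sup>2))"
    by (intro suminf_ennreal2 sum) simp
  finally have "(\<integral>\<^sup>+\<omega>. (\<Sum>n. ennreal ((X n \<omega>)\<^sup>2)) \<partial>M) \<noteq> \<infinity>"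
    by simp
  then have "AE \<omega> in M. (\<Sum>n. ennreal ((X n \<omega>)\<^sup>2)) \<noteq> \<infinity>"
    by (intro nn_integral_noteq_infinite) measurable
  then show ?thesis
  proof eventually_elim
    case (elim \<omega>)
    then have "summable (\<lambda>n. (X n \<omega>)\<^sup>2)"
      by (intro summable_suminf_not_top) auto
    then have "(\<lambda>n. (X n \<omega>)\<^sup>2) \<longlonglongrightarrow> 0"
      by (rule summable_LIMSEQ_zero)
    then show ?case by simp
  qed
qed

lemma cube_shift_disjoint:
  assumes "y - x \<notin> cube (2 * r)"
  shows "(\<lambda>z. z + x) ` cube r \<inter> (\<lambda>z. z + y) ` cube r = {}"
proof (rule ccontr)
  assume "\<not> ?thesis"
  then obtain z w where zw: "z \<in> cube r" "w \<in> cube r" "z + x = w + y"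
    by blast
  then have "y - x = z + - w"
    by (simp add: algebra_simps)
  then show False
    using assms cube_add[OF zw(1) cube_uminus[OF zw(2)]] by (simp add: mult_2)
qed

text \<open>
  Sites further apart than twice the range contribute independent summands, so at most
  \<open>card (cube n) * card (cube (2 * r))\<close> of the mixed moments survive, each of them at most 1.
\<close>

lemma second_moment_cube_sum_le:
  fixes g :: "('d::finite site \<Rightarrow> real) \<Rightarrow> real"
  assumes [measurable]: "g \<in> borel_measurable Omega_measure"
    and bounds: "\<And>\<omega>. 0 \<le> g \<omega>" "\<And>\<omega>. g \<omega> \<le> 1"
    and local: "\<And>\<omega> \<omega>'. (\<And>z. z \<in> cube r \<Longrightarrow> \<omega> z = \<omega>' z) \<Longrightarrow> g \<omega> = g \<omega>'"
  defines "c \<equiv> Omega.expectation g"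
  shows "Omega.expectation (\<lambda>\<omega>. (\<Sum>x\<in>cube n. g (\<lambda>y. \<omega> (y + x)) - c)\<^sup>2) \<le>
    real (card (cube n :: 'd site set)) * real (card (cube (2 * r) :: 'd site set))"
proof -
  define h where "h x \<omega> = g (\<lambda>y. \<omega> (y + x)) - c" for x :: "'d site" and \<omega>
  have int_g: "integrable Omega_measure g"
    using bounds by (intro Omega.integrable_const_bound[where B = 1]) auto
  have c: "0 \<le> c" "c \<le> 1"
    using bounds int_g by (auto simp: c_def intro!: Omega.integral_ge_const Omega.integral_le_const)
  have h_meas [measurable]: "h x \<in> borel_measurable Omega_measure" for x
    unfolding h_def by measurable
  have abs_h: "\<bar>h x \<omega>\<bar> \<le> 1" for x \<omega>
    using bounds[of "\<lambda>y. \<omega> (y + x)"] c by (auto simp: h_def abs_le_iff)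
  have int_h: "integrable Omega_measure (h x)" for x
    using abs_h by (intro Omega.integrable_const_bound[where B = 1]) auto
  have abs_hh: "\<bar>h x \<omega> * h y \<omega>\<bar> \<le> 1" for x y \<omega>
    using abs_h[of x \<omega>] abs_h[of y \<omega>] by (simp add: abs_mult mult_le_one)
  have int_hh: "integrable Omega_measure (\<lambda>\<omega>. h x \<omega> * h y \<omega>)" for x y
    using abs_hh by (intro Omega.integrable_const_bound[where B = 1]) auto
  have mean_h: "Omega.expectation (h x) = 0" for x
  proof -
    have "integrable Omega_measure (\<lambda>\<omega>. g (\<lambda>y. \<omega> (y + x)))"
      using bounds by (intro Omega.integrable_const_bound[where B = 1]) auto
    then show ?thesis
      unfolding h_def by (simp add: c_def integral_Omega_shift Omega.prob_space)
  qed
  have h_local: "h x \<omega> = h x \<omega>'" if "\<And>z. z \<in> (\<lambda>z. z + x) ` cube r \<Longrightarrow> \<omega> z = \<omega>' z" for x \<omega> \<omega>'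
    unfolding h_def using that by (subst local[of "\<lambda>y. \<omega> (y + x)" "\<lambda>y. \<omega>' (y + x)"]) auto
  have cov: "Omega.expectation (\<lambda>\<omega>. h x \<omega> * h y \<omega>) \<le> of_bool (y - x \<in> cube (2 * r))" for x y
  proof (cases "y - x \<in> cube (2 * r)")
    case True
    have "Omega.expectation (\<lambda>\<omega>. h x \<omega> * h y \<omega>) \<le> 1"
      using abs_hh by (intro Omega.integral_le_const int_hh) (auto simp: abs_le_iff)
    then show ?thesis using True by simp
  next
    case False
    have "Omega.expectation (\<lambda>\<omega>. h x \<omega> * h y \<omega>) = Omega.expectation (h x) * Omega.expectation (h y)"
      using h_local[of x] h_local[of y]
      by (rule integral_mult_disjoint_supports[OF h_meas h_meas int_h int_h _ _
            cube_shift_disjoint[OF False]])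
    then show ?thesis using False by (simp add: mean_h)
  qed
  have "Omega.expectation (\<lambda>\<omega>. (\<Sum>x\<in>cube n. h x \<omega>)\<^sup>2) =
      (\<Sum>x\<in>cube n. \<Sum>y\<in>cube n. Omega.expectation (\<lambda>\<omega>. h x \<omega> * h y \<omega>))"
    using int_hh by (simp add: power2_eq_square sum_product)
  also have "\<dots> \<le> (\<Sum>x\<in>(cube n :: 'd site set). \<Sum>y\<in>cube n. of_bool (y - x \<in> cube (2 * r)))"
    by (intro sum_mono cov)
  also have "\<dots> \<le> (\<Sum>x\<in>(cube n :: 'd site set). real (card (cube (2 * r) :: 'd site set)))"
  proof (rule sum_mono)
    fix x :: "'d site"
    have "(\<Sum>y\<in>cube n. of_bool (y - x \<in> cube (2 * r)) :: real) = real (card {y \<in> cube n. y - x \<in> cube (2 * r)})"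
      by (simp add: of_bool_def sum.If_cases finite_cube Int_def)
    also have "card {y \<in> cube n. y - x \<in> cube (2 * r)} \<le> card ((\<lambda>z. z + x) ` cube (2 * r))"
      by (intro card_mono finite_imageI finite_cube) force
    also have "\<dots> \<le> card (cube (2 * r) :: 'd site set)"
      by (intro card_image_le finite_cube)
    finally show "(\<Sum>y\<in>cube n. of_bool (y - x \<in> cube (2 * r)) :: real) \<le>
        real (card (cube (2 * r) :: 'd site set))"
      by simp
  qed
  finally show ?thesis
    by (simp add: h_def)
qed

text \<open>
  Convergence along the squares implies convergence: between consecutive squares the sums are
  monotone, and the volumes of consecutive squares are asymptotically equal.
\<close>

lemma cube_average_tendsto_if_squares:
  fixes u :: "'d::finite site \<Rightarrow> real"
  assumes nonneg: "\<And>x. 0 \<le> u x"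
    and lim: "(\<lambda>j. (\<Sum>x\<in>cube (j\<^sup>2). u x) / (2 * real (j\<^sup>2) + 1) ^ CARD('d)) \<longlonglongrightarrow> c"
  shows "(\<lambda>n. (\<Sum>x\<in>cube n. u x) / (2 * real n + 1) ^ CARD('d)) \<longlonglongrightarrow> c"
proof -
  define T where "T n = (\<Sum>x\<in>(cube n :: 'd site set). u x)" for n
  define V where "V n = (2 * real n + 1) ^ CARD('d)" for n
  have V: "V n > 0" for n by (simp add: V_def)
  have T_mono: "T m \<le> T n" if "m \<le> n" for m n
    unfolding T_def using that nonneg by (intro sum_mono2 finite_cube cube_mono) auto
  have T_nonneg: "0 \<le> T n" for n
    unfolding T_def using nonneg by (simp add: sum_nonneg)
  have V_mono: "V m \<le> V n" if "m \<le> n" for m n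
    unfolding V_def using that by (intro power_mono) auto
  have ratio: "(\<lambda>j. V (j\<^sup>2) / V ((Suc j)\<^sup>2)) \<longlonglongrightarrow> 1"
  proof -
    have "(\<lambda>j. (2 * real (j\<^sup>2) + 1) / (2 * real ((Suc j)\<^sup>2) + 1)) \<longlonglongrightarrow> 1"
      by real_asymp
    then have "(\<lambda>j. ((2 * real (j\<^sup>2) + 1) / (2 * real ((Suc j)\<^sup>2) + 1)) ^ CARD('d)) \<longlonglongrightarrow> 1 ^ CARD('d)"
      by (rule tendsto_power)
    then show ?thesis by (simp add: V_def power_divide)
  qed
  have lim': "(\<lambda>j. T (j\<^sup>2) / V (j\<^sup>2)) \<longlonglongrightarrow> c"
    using lim by (simp add: T_def V_def)
  have "(\<lambda>j. T (j\<^sup>2) / V (j\<^sup>2) * (V (j\<^sup>2) / V ((Suc j)\<^sup>2))) \<longlonglongrightarrow> c * 1"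
    by (intro tendsto_mult lim' ratio)
  then have lower: "(\<lambda>j. T (j\<^sup>2) / V ((Suc j)\<^sup>2)) \<longlonglongrightarrow> c"
    using V by (simp add: less_imp_neq[THEN not_sym])
  have "(\<lambda>j. T ((Suc j)\<^sup>2) / V ((Suc j)\<^sup>2) / (V (j\<^sup>2) / V ((Suc j)\<^sup>2))) \<longlonglongrightarrow> c / 1"
    using lim'[THEN LIMSEQ_Suc] ratio by (intro tendsto_divide) auto
  then have upper: "(\<lambda>j. T ((Suc j)\<^sup>2) / V (j\<^sup>2)) \<longlonglongrightarrow> c"
    using V by (simp add: less_imp_neq[THEN not_sym])
  have "filterlim floor_sqrt at_top sequentially"
    unfolding filterlim_at_top eventually_sequentially by (meson le_floor_sqrt_iff)
  note at_floor_sqrt = filterlim_compose[OF _ this]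
  have "(\<lambda>n. T n / V n) \<longlonglongrightarrow> c"
  proof (rule tendsto_sandwich[OF _ _ at_floor_sqrt[OF lower] at_floor_sqrt[OF upper]];
      intro always_eventually allI)
    fix n
    have le: "(floor_sqrt n)\<^sup>2 \<le> n" "n \<le> (Suc (floor_sqrt n))\<^sup>2"
      using floor_sqrt_power2_le[of n] Suc_floor_sqrt_power2_gt[of n] by linarith+
    show "T ((floor_sqrt n)\<^sup>2) / V ((Suc (floor_sqrt n))\<^sup>2) \<le> T n / V n"
      by (intro frac_le T_nonneg T_mono V V_mono le)
    show "T n / V n \<le> T ((Suc (floor_sqrt n))\<^sup>2) / V ((floor_sqrt n)\<^sup>2)"
      by (intro frac_le T_nonneg T_mono V V_mono le)
  qed
  then show ?thesis
    by (simp add: T_def V_def)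
qed

text \<open>
  The second moment of the centred average is at most a constant over \<open>2 * n + 1\<close>, whatever the
  dimension. In dimension one this is not summable in \<open>n\<close>, hence the detour along the squares.
\<close>

lemma AE_cube_average_tendsto_expectation:
  fixes g :: "('d::finite site \<Rightarrow> real) \<Rightarrow> real"
  assumes [measurable]: "g \<in> borel_measurable Omega_measure"
    and bounds: "\<And>\<omega>. 0 \<le> g \<omega>" "\<And>\<omega>. g \<omega> \<le> 1"
    and local: "\<And>\<omega> \<omega>'. (\<And>z. z \<in> cube r \<Longrightarrow> \<omega> z = \<omega>' z) \<Longrightarrow> g \<omega> = g \<omega>'"
  shows "AE \<omega> in Omega_measure.
    (\<lambda>n. (\<Sum>x\<in>cube n. g (\<lambda>y. \<omega> (y + x))) / (2 * real n + 1) ^ CARD('d))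
      \<longlonglongrightarrow> Omega.expectation g"
proof -
  define c where "c = Omega.expectation g"
  define V where "V n = (2 * real n + 1) ^ CARD('d)" for n
  define K where "K = real (card (cube (2 * r) :: 'd site set))"
  have V: "V n > 0" "2 * real n + 1 \<le> V n" for n
    using self_le_power[of "2 * real n + 1" "CARD('d)"] by (simp_all add: V_def)
  have card_V: "real (card (cube n :: 'd site set)) = V n" for n
    by (simp add: card_cube V_def add.commute)
  define X where "X j \<omega> = (\<Sum>x\<in>cube (j\<^sup>2). g (\<lambda>y. \<omega> (y + x)) - c) / V (j\<^sup>2)"
    for j and \<omega> :: "'d site \<Rightarrow> real"
  have X_eq: "X j \<omega> = (\<Sum>x\<in>cube (j\<^sup>2). g (\<lambda>y. \<omega> (y + x))) / V (j\<^sup>2) - c" for j \<omega>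
    using V(1)[of "j\<^sup>2"] by (simp add: X_def sum_subtractf card_V diff_divide_distrib)
  have [measurable]: "X j \<in> borel_measurable Omega_measure" for j
    unfolding X_def by measurable
  have int_g: "integrable Omega_measure g"
    using bounds by (intro Omega.integrable_const_bound[where B = 1]) auto
  have c: "0 \<le> c" "c \<le> 1"
    using bounds int_g by (auto simp: c_def intro!: Omega.integral_ge_const Omega.integral_le_const)
  have abs_X: "\<bar>X j \<omega>\<bar> \<le> 1" for j \<omega>
  proof -
    have "\<bar>\<Sum>x\<in>cube (j\<^sup>2). g (\<lambda>y. \<omega> (y + x)) - c\<bar> \<le> (\<Sum>x\<in>(cube (j\<^sup>2) :: 'd site set). 1)"
    proof (rule order_trans[OF sum_abs sum_mono])
      fix x show "\<bar>g (\<lambda>y. \<omega> (y + x)) - c\<bar> \<le> 1"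
        using bounds[of "\<lambda>y. \<omega> (y + x)"] c by (auto simp: abs_le_iff)
    qed
    then show ?thesis
      using V(1)[of "j\<^sup>2"] by (simp add: X_def card_V)
  qed
  have second: "Omega.expectation (\<lambda>\<omega>. (X j \<omega>)\<^sup>2) \<le> K * (1 / (2 * real (j\<^sup>2) + 1))" for j
  proof -
    have "Omega.expectation (\<lambda>\<omega>. (X j \<omega>)\<^sup>2) =
        Omega.expectation (\<lambda>\<omega>. (\<Sum>x\<in>cube (j\<^sup>2). g (\<lambda>y. \<omega> (y + x)) - c)\<^sup>2) / (V (j\<^sup>2))\<^sup>2"
      by (simp add: X_def power_divide)
    also have "\<dots> \<le> V (j\<^sup>2) * K / (V (j\<^sup>2))\<^sup>2"
      using second_moment_cube_sum_le[where r = r and n = "j\<^sup>2", OF assms] by (intro divide_right_mono) (simp_all add: c_def K_def card_V)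
    also have "\<dots> = K * (1 / V (j\<^sup>2))"
      using V(1)[of "j\<^sup>2"] by (simp add: power2_eq_square field_simps)
    also have "\<dots> \<le> K * (1 / (2 * real (j\<^sup>2) + 1))"
      using V(2)[of "j\<^sup>2"] by (intro mult_left_mono divide_left_mono) (auto simp: K_def V add_nonneg_pos)
    finally show ?thesis .
  qed
  have "summable (\<lambda>j. Omega.expectation (\<lambda>\<omega>. (X j \<omega>)\<^sup>2))"
  proof (rule summable_comparison_test'[where N = 1])
    show "summable (\<lambda>j. K * (1 / real j ^ 2))"
      using inverse_power_summable[of 2, where 'a = real]
      by (intro summable_mult) (simp add: divide_inverse)
    fix j :: nat assume "1 \<le> j"
    have "norm (Omega.expectation (\<lambda>\<omega>. (X j \<omega>)\<^sup>2)) \<le> K * (1 / (2 * real (j\<^sup>2) + 1))"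
      using second[of j] by simp
    also have "\<dots> \<le> K * (1 / real j ^ 2)"
      using \<open>1 \<le> j\<close> by (intro mult_left_mono divide_left_mono) (auto simp: K_def add_nonneg_pos)
    finally show "norm (Omega.expectation (\<lambda>\<omega>. (X j \<omega>)\<^sup>2)) \<le> K * (1 / real j ^ 2)" .
  qed
  moreover have "integrable Omega_measure (\<lambda>\<omega>. (X j \<omega>)\<^sup>2)" for j
    using abs_X by (intro Omega.integrable_const_bound[where B = 1]) (auto simp: abs_square_le_1)
  ultimately have "AE \<omega> in Omega_measure. (\<lambda>j. X j \<omega>) \<longlonglongrightarrow> 0"
    by (intro Omega.AE_tendsto_0_if_summable_second_moments) auto
  then show ?thesis
  proof eventually_elim
    case (elim \<omega>)
    then have "(\<lambda>j. (\<Sum>x\<in>cube (j\<^sup>2). g (\<lambda>y. \<omega> (y + x))) / V (j\<^sup>2)) \<longlonglongrightarrow> c"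
      by (simp add: X_eq LIM_zero_iff)
    then show ?case
      using bounds(1) unfolding V_def c_def by (intro cube_average_tendsto_if_squares)
  qed
qed

section \<open>Convergence of the occupation density\<close>

lemma finite_parking_scheme:
  assumes "parking_scheme \<nu> (S :: 'd::finite config set)"
  shows "finite S"
proof (rule finite_subset)
  show "S \<subseteq> cube \<nu> \<rightarrow>\<^sub>E UNIV" using assms by (simp add: parking_scheme_def)
  show "finite ((cube \<nu> :: 'd site set) \<rightarrow>\<^sub>E (UNIV :: bool set))"
    by (intro finite_PiE finite_cube) simp
qed

lemma restrict_in_parking_scheme_iff:
  assumes "parking_scheme \<nu> S"
  shows "restrict \<eta> (cube \<nu>) \<in> S \<longleftrightarrow> (\<exists>s\<in>S. \<forall>z\<in>cube \<nu>. \<eta> z = s z)"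
proof
  assume "\<exists>s\<in>S. \<forall>z\<in>cube \<nu>. \<eta> z = s z"
  then obtain s where s: "s \<in> S" "\<forall>z\<in>cube \<nu>. \<eta> z = s z" by blast
  then have "s \<in> cube \<nu> \<rightarrow>\<^sub>E UNIV"
    using assms by (auto simp: parking_scheme_def)
  then have "restrict \<eta> (cube \<nu>) = s"
    using s(2) by (auto simp: fun_eq_iff PiE_iff extensional_def)
  then show "restrict \<eta> (cube \<nu>) \<in> S" using s(1) by simp
qed (auto intro!: bexI[of _ "restrict \<eta> (cube \<nu>)"])

lemma pred_iterated_parking:
  fixes S :: "'d::finite config set"
  assumes "parking_scheme \<nu> S"
  shows "Measurable.pred Omega_measure (\<lambda>\<omega>. iterated_parking \<nu> S k \<omega> x)"
proof (induction k arbitrary: x)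
  case (Suc k)
  note Suc [measurable]
  show ?case
    unfolding iterated_parking.simps restrict_in_parking_scheme_iff[OF assms] translate_def
    by (intro pred_intros_finite finite_parking_scheme[OF assms] finite_cube) measurable
qed (simp add: zero_config_def)

text \<open>
  An infinite decreasing path is an uncountable existential; Koenig's lemma has replaced it by
  countable quantifiers.
\<close>

lemma pred_exceptional [measurable]:
  "Measurable.pred (Omega_measure :: ('d::finite site \<Rightarrow> real) measure) (\<lambda>\<omega>. exceptional \<nu> \<omega>)"
proof -
  have "Measurable.pred Omega_measure (\<lambda>\<omega>. \<omega> x = \<omega> y)" for x y :: "'d site"
    unfolding pred_def by (intro borel_measurable_eq measurable_label)
  then show ?thesis
    unfolding exceptional_iff inj_def
    by (intro pred_intros_logic pred_intros_countable pred_descends) auto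
qed

text \<open>
  Off the exceptional set some depth suffices at every site, so that the limit algorithm is a
  countable combination of local functions, and therefore measurable.
\<close>

lemma limit_algorithm_iff:
  "limit_algorithm \<nu> S \<omega> x \<longleftrightarrow>
     \<not> exceptional \<nu> \<omega> \<and> (\<exists>k. \<not> descends \<nu> k \<omega> x \<and> iterated_parking \<nu> S k \<omega> x)"
proof (cases "exceptional \<nu> \<omega>")
  case True
  then show ?thesis by (simp add: limit_algorithm_def zero_config_def)
next
  case False
  then obtain k where "\<not> descends \<nu> k \<omega> x"
    by (auto simp: exceptional_iff)
  then show ?thesis
    using False limit_algorithm_eq_iterated_parking by blast
qed

lemma pred_limit_algorithm:
  fixes S :: "'d::finite config set"
  assumes "parking_scheme \<nu> S"
  shows "Measurable.pred Omega_measure (\<lambda>\<omega>. limit_algorithm \<nu> S \<omega> x)"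
proof -
  note pred_iterated_parking[OF assms, measurable]
  show ?thesis unfolding limit_algorithm_iff by measurable
qed

lemma integrable_of_bool:
  assumes "Measurable.pred (Omega_measure :: ('d::finite site \<Rightarrow> real) measure) A"
  shows "integrable Omega_measure (\<lambda>\<omega>. of_bool (A \<omega>) :: real)"
  using assms by (intro Omega.integrable_const_bound[where B = 1]) auto

lemma expectation_of_bool:
  fixes A :: "('d::finite site \<Rightarrow> real) \<Rightarrow> bool"
  shows "Omega.expectation (\<lambda>\<omega>. of_bool (A \<omega>)) = Omega.prob {\<omega> \<in> space Omega_measure. A \<omega>}"
proof -
  have "Omega.expectation (\<lambda>\<omega>. of_bool (A \<omega>)) =
      Omega.expectation (indicat_real {\<omega> \<in> space Omega_measure. A \<omega>})"
    by (intro Bochner_Integration.integral_cong) auto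
  then show ?thesis by (simp add: Int_absorb2 Collect_restrict)
qed

lemma AE_cube_frequency_tendsto:
  fixes A :: "('d::finite site \<Rightarrow> real) \<Rightarrow> 'd site \<Rightarrow> bool"
  assumes [measurable]: "Measurable.pred Omega_measure (\<lambda>\<omega>. A \<omega> 0)"
    and shift: "\<And>\<omega> x. A (\<lambda>y. \<omega> (y + x)) 0 = A \<omega> x"
    and local: "\<And>\<omega> \<omega>'. (\<And>z. z \<in> cube r \<Longrightarrow> \<omega> z = \<omega>' z) \<Longrightarrow> A \<omega> 0 = A \<omega>' 0"
  shows "AE \<omega> in Omega_measure.
    (\<lambda>n. (\<Sum>x\<in>cube n. of_bool (A \<omega> x)) / (2 * real n + 1) ^ CARD('d))
      \<longlonglongrightarrow> Omega.prob {\<omega> \<in> space Omega_measure. A \<omega> 0}"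
proof -
  have "AE \<omega> in Omega_measure.
    (\<lambda>n. (\<Sum>x\<in>cube n. of_bool (A (\<lambda>y. \<omega> (y + x)) 0)) / (2 * real n + 1) ^ CARD('d))
      \<longlonglongrightarrow> Omega.expectation (\<lambda>\<omega>. of_bool (A \<omega> 0))"
  proof (rule AE_cube_average_tendsto_expectation[where r = r])
    fix \<omega> \<omega>' :: "'d site \<Rightarrow> real"
    assume "\<And>z. z \<in> cube r \<Longrightarrow> \<omega> z = \<omega>' z"
    then show "of_bool (A \<omega> 0) = (of_bool (A \<omega>' 0) :: real)"
      using local[of \<omega> \<omega>'] by simp
  qed auto
  then show ?thesis
    by (simp add: shift expectation_of_bool)
qed

text \<open>
  The process on \<open>cube n\<close> and the \<open>k\<close>-th iterate can differ only where a decreasing path with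
  \<open>k\<close> steps starts, or in the boundary layer that such a path could leave.
\<close>

lemma occupation_density_approx:
  fixes S :: "'d::finite config set"
  assumes "\<not> exceptional \<nu> \<omega>" "k * \<nu> \<le> n"
  defines "V \<equiv> \<lambda>n. (2 * real n + 1) ^ CARD('d)"
  shows "\<bar>occupation_density \<nu> S n \<omega> - (\<Sum>x\<in>cube n. of_bool (iterated_parking \<nu> S k \<omega> x)) / V n\<bar>
    \<le> (\<Sum>x\<in>cube n. of_bool (descends \<nu> k \<omega> x)) / V n + (1 - V (n - k * \<nu>) / V n)"
proof -
  let ?P = "\<lambda>x. of_bool (parking_cube \<nu> S n \<omega> x) :: real"
    and ?Q = "\<lambda>x. of_bool (iterated_parking \<nu> S k \<omega> x) :: real"
    and ?D = "\<lambda>x. of_bool (descends \<nu> k \<omega> x) :: real"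
  have V: "V n > 0" by (simp add: V_def)
  have card_V: "real (card (cube m :: 'd site set)) = V m" for m
    by (simp add: card_cube V_def add.commute)
  have density: "occupation_density \<nu> S n \<omega> = (\<Sum>x\<in>cube n. ?P x) / V n"
    by (simp add: occupation_density_def V_def)
  have sub: "cube (n - k * \<nu>) \<subseteq> (cube n :: 'd site set)"
    by (rule cube_mono) simp
  have "\<bar>(\<Sum>x\<in>cube n. ?P x) - (\<Sum>x\<in>cube n. ?Q x)\<bar> \<le> (\<Sum>x\<in>cube n. \<bar>?P x - ?Q x\<bar>)"
    by (simp add: sum_abs flip: sum_subtractf)
  also have "\<dots> \<le> (\<Sum>x\<in>cube n. ?D x + of_bool (x \<notin> cube (n - k * \<nu>)))"
  proof (rule sum_mono)
    fix x
    show "\<bar>?P x - ?Q x\<bar> \<le> ?D x + of_bool (x \<notin> cube (n - k * \<nu>))"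
      using parking_cube_eq_iterated_parking[OF assms(1), of k x "n - k * \<nu>" n S] assms(2)
      by (cases "descends \<nu> k \<omega> x"; cases "x \<in> cube (n - k * \<nu>)") auto
  qed
  also have "\<dots> = (\<Sum>x\<in>cube n. ?D x) + real (card (cube n - cube (n - k * \<nu>) :: 'd site set))"
    by (simp add: sum.distrib of_bool_def sum.If_cases finite_cube Diff_eq Collect_neg_eq)
  also have "real (card (cube n - cube (n - k * \<nu>) :: 'd site set)) = V n - V (n - k * \<nu>)"
    using sub by (simp add: card_Diff_subset finite_cube card_mono of_nat_diff card_V)
  finally have "\<bar>(\<Sum>x\<in>cube n. ?P x) - (\<Sum>x\<in>cube n. ?Q x)\<bar> / V n \<le>
      ((\<Sum>x\<in>cube n. ?D x) + (V n - V (n - k * \<nu>))) / V n"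
    using V by (intro divide_right_mono) auto
  moreover have "\<bar>occupation_density \<nu> S n \<omega> - (\<Sum>x\<in>cube n. ?Q x) / V n\<bar> =
      \<bar>(\<Sum>x\<in>cube n. ?P x) - (\<Sum>x\<in>cube n. ?Q x)\<bar> / V n"
    unfolding density using V by (simp add: abs_divide flip: diff_divide_distrib)
  ultimately show ?thesis
    using V by (simp add: add_divide_distrib diff_divide_distrib)
qed

lemma cube_volume_ratio_tendsto_1:
  "(\<lambda>n. (2 * real (n - m) + 1) ^ d / (2 * real n + 1) ^ d) \<longlonglongrightarrow> 1"
proof -
  have "(\<lambda>n. (2 * (real n - real m) + 1) / (2 * real n + 1)) \<longlonglongrightarrow> 1"
    by real_asymp
  moreover have "\<forall>\<^sub>F n in sequentially. (2 * (real n - real m) + 1) / (2 * real n + 1) =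
      (2 * real (n - m) + 1) / (2 * real n + 1)"
    using eventually_ge_at_top[of m] by eventually_elim (simp add: of_nat_diff)
  ultimately have "(\<lambda>n. (2 * real (n - m) + 1) / (2 * real n + 1)) \<longlonglongrightarrow> 1"
    by (rule Lim_transform_eventually)
  then have "(\<lambda>n. ((2 * real (n - m) + 1) / (2 * real n + 1)) ^ d) \<longlonglongrightarrow> 1 ^ d"
    by (rule tendsto_power)
  then show ?thesis by (simp add: power_divide)
qed

text \<open>
  The limit algorithm and the \<open>k\<close>-th iterate can differ at the origin only if a decreasing path
  with \<open>k\<close> steps starts there, or on a null set.
\<close>

lemma limit_density_approx:
  fixes S :: "'d::finite config set"
  assumes "parking_scheme \<nu> S"
  shows "\<bar>Omega.prob {\<omega> \<in> space Omega_measure. iterated_parking \<nu> S k \<omega> 0} - limit_density \<nu> S\<bar>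
    \<le> Omega.prob {\<omega> \<in> space (Omega_measure :: ('d site \<Rightarrow> real) measure). descends \<nu> k \<omega> 0}"
proof -
  let ?P = "\<lambda>\<omega>. of_bool (limit_algorithm \<nu> S \<omega> 0) :: real"
    and ?Q = "\<lambda>\<omega>. of_bool (iterated_parking \<nu> S k \<omega> 0) :: real"
    and ?D = "\<lambda>\<omega> :: 'd site \<Rightarrow> real. of_bool (descends \<nu> k \<omega> 0) :: real"
  have int: "integrable Omega_measure ?P" "integrable Omega_measure ?Q" "integrable Omega_measure ?D"
    by (intro integrable_of_bool pred_limit_algorithm pred_iterated_parking pred_descends assms)+
  have "\<bar>Omega.expectation (\<lambda>\<omega>. ?Q \<omega> - ?P \<omega>)\<bar> \<le> Omega.expectation (\<lambda>\<omega>. \<bar>?Q \<omega> - ?P \<omega>\<bar>)"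
    by (rule integral_abs_bound)
  also have "\<dots> \<le> Omega.expectation ?D"
  proof (rule integral_mono_AE)
    show "AE \<omega> in Omega_measure. \<bar>?Q \<omega> - ?P \<omega>\<bar> \<le> ?D \<omega>"
      using AE_not_exceptional[of \<nu>]
    proof eventually_elim
      case (elim \<omega>)
      then show ?case
        using limit_algorithm_eq_iterated_parking[of \<nu> \<omega> k 0 S]
        by (cases "descends \<nu> k \<omega> 0") auto
    qed
  qed (use int in auto)
  finally show ?thesis
    using int by (simp add: limit_density_def expectation_of_bool)
qed

theorem theorem4p2:
  fixes S :: "'d::finite config set" and \<nu> :: nat
  assumes "\<nu> \<ge> 1"
    and "parking_scheme \<nu> S"
  shows "integrable (Omega_measure :: ('d site \<Rightarrow> real) measure)
           (\<lambda>\<omega>. of_bool (limit_algorithm \<nu> S \<omega> 0) :: real) \<and>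
         limit_density \<nu> S \<in> {0..1} \<and>
         (AE \<omega> in (Omega_measure :: ('d site \<Rightarrow> real) measure).
            (\<lambda>n. occupation_density \<nu> S n \<omega>) \<longlonglongrightarrow> limit_density \<nu> S)"
proof (intro conjI)
  show "integrable (Omega_measure :: ('d site \<Rightarrow> real) measure)
      (\<lambda>\<omega>. of_bool (limit_algorithm \<nu> S \<omega> 0) :: real)"
    by (intro integrable_of_bool pred_limit_algorithm assms)
  show "limit_density \<nu> S \<in> {0..1}"
    by (simp add: limit_density_def expectation_of_bool)
  define V where "V n = (2 * real n + 1) ^ CARD('d)" for n
  define q where "q k = Omega.prob {\<omega> \<in> space Omega_measure. iterated_parking \<nu> S k \<omega> 0}" for k
  define p where "p k = Omega.prob
      {\<omega> \<in> space (Omega_measure :: ('d site \<Rightarrow> real) measure). descends \<nu> k \<omega> 0}" for k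
  have "AE \<omega> in Omega_measure.
      (\<lambda>n. (\<Sum>x\<in>cube n. of_bool (iterated_parking \<nu> S k \<omega> x)) / V n) \<longlonglongrightarrow> q k" for k
    unfolding V_def q_def
    by (rule AE_cube_frequency_tendsto[where r = "k * \<nu>",
          OF pred_iterated_parking[OF assms(2)] _ iterated_parking_cong])
      (simp_all add: iterated_parking_shift)
  then have "AE \<omega> in Omega_measure. \<forall>k.
      (\<lambda>n. (\<Sum>x\<in>cube n. of_bool (iterated_parking \<nu> S k \<omega> x)) / V n) \<longlonglongrightarrow> q k"
    by (simp add: AE_all_countable)
  moreover have "AE \<omega> in (Omega_measure :: ('d site \<Rightarrow> real) measure).
      (\<lambda>n. (\<Sum>x\<in>cube n. of_bool (descends \<nu> k \<omega> x)) / V n) \<longlonglongrightarrow> p k" for k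
    unfolding V_def p_def
    by (rule AE_cube_frequency_tendsto[where r = "k * \<nu>", OF pred_descends _ descends_cong])
      (simp_all add: descends_shift)
  then have "AE \<omega> in (Omega_measure :: ('d site \<Rightarrow> real) measure). \<forall>k.
      (\<lambda>n. (\<Sum>x\<in>cube n. of_bool (descends \<nu> k \<omega> x)) / V n) \<longlonglongrightarrow> p k"
    by (simp add: AE_all_countable)
  moreover note AE_not_exceptional[of \<nu>]
  ultimately show "AE \<omega> in (Omega_measure :: ('d site \<Rightarrow> real) measure).
      (\<lambda>n. occupation_density \<nu> S n \<omega>) \<longlonglongrightarrow> limit_density \<nu> S"
  proof eventually_elim
    case (elim \<omega>)
    define a where "a k n = (\<Sum>x\<in>cube n. of_bool (iterated_parking \<nu> S k \<omega> x)) / V n" for k n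
    define b where "b k n = (\<Sum>x\<in>cube n. of_bool (descends \<nu> k \<omega> x)) / V n" for k n
    show ?case
    proof (rule tendstoI)
      fix e :: real assume "e > 0"
      \<comment> \<open>The error \<open>p k\<close> enters twice: in the truncation of the process on the cube, and in the
        truncation of the limit algorithm.\<close>
      then have "\<forall>\<^sub>F k in sequentially. p k < e / 2"
        using order_tendstoD(2)[OF prob_descends_tendsto_0, of "e / 2" \<nu> 0] by (simp add: p_def)
      then obtain k where k: "p k < e / 2"
        using eventually_happens'[OF sequentially_bot] by blast
      have "(\<lambda>n. \<bar>a k n - q k\<bar> + (b k n + (1 - V (n - k * \<nu>) / V n)) + p k)
          \<longlonglongrightarrow> \<bar>q k - q k\<bar> + (p k + (1 - 1)) + p k"
        using elim(1,2) cube_volume_ratio_tendsto_1[of "k * \<nu>" "CARD('d)"]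
        unfolding a_def b_def V_def by (intro tendsto_intros) auto
      then have "\<forall>\<^sub>F n in sequentially.
          \<bar>a k n - q k\<bar> + (b k n + (1 - V (n - k * \<nu>) / V n)) + p k < e"
        by (rule order_tendstoD(2)) (use k in simp)
      then show "\<forall>\<^sub>F n in sequentially. dist (occupation_density \<nu> S n \<omega>) (limit_density \<nu> S) < e"
        using eventually_ge_at_top[of "k * \<nu>"]
      proof eventually_elim
        case (elim n)
        have "\<bar>occupation_density \<nu> S n \<omega> - a k n\<bar> \<le> b k n + (1 - V (n - k * \<nu>) / V n)"
          using occupation_density_approx[OF \<open>\<not> exceptional \<nu> \<omega>\<close> elim(2), of S]
          by (simp add: a_def b_def V_def)
        moreover have "\<bar>q k - limit_density \<nu> S\<bar> \<le> p k"
          unfolding q_def p_def by (rule limit_density_approx[OF assms(2)])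
        ultimately show ?case
          using elim(1) unfolding dist_real_def by linarith
      qed
    qed
  qed
qed

end
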